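(* Let $\alpha\in(0,1]$ and consider all quantum teleportation protocols (QTPs) whose average fidelity satisfies $\langle\bar F\rangle=\alpha$. Among these protocols, the average trace distance $\langle\bar D_{\mathrm T}\rangle$ takes its minimum value for those that align. Explicitly: let $Q$ be a QTP with $\langle\bar F\rangle_Q=\alpha$ that aligns, i.e. there are constants $s_m\in(0,1]$ (independent of the input) such that the Bloch vector of the output state $\hat\rho^{\mathrm{out}}_m$ is $\mathbf t_m=s_m\mathbf t$ for every outcome $m$ and every input Bloch vector $\mathbf t$, with $\sum_m P_m s_m=2\alpha-1$. Then for every QTP $Q'$ with $\langle\bar F\rangle_{Q'}=\alpha$ one has $$\langle\bar D_{\mathrm T}\rangle_{Q}\le\langle\bar D_{\mathrm T}\rangle_{Q'} .$$
   Context: All systems $\bar a,a,b$ are qubits; $\hat{\boldsymbol\sigma}=(\hat\sigma_1,\hat\sigma_2,\hat\sigma_3)^{\top}$ are the Pauli operators. A (general) quantum teleportation protocol (QTP) consists of the following data. 1. A resource state $\hat\rho^{ab}$, an arbitrary two-qubit density operator, with Fano form $\hat\rho^{ab}=\frac14\big(\hat 1\otimes\hat 1+(\mathbf r^a)^\top\hat{\boldsymbol\sigma}\otimes\hat 1+\hat 1\otimes(\mathbf r^b)^\top\hat{\boldsymbol\sigma}+\sum_{i,j=1}^3 r_{ij}\,\hat\sigma_i\otimes\hat\sigma_j\big)$, where $\mathbf r^a,\mathbf r^b\in\mathbb R^3$ are the Bloch vectors of the reduced states and $r=(r_{ij})\in\mathbb R^{3\times3}$ is the correlation matrix. 2. A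 finite POVM $\{\hat E_m\}$ on the qubits $\bar a a$: nonzero positive semidefinite operators with $\sum_m\hat E_m=\hat 1\otimes\hat 1$. Put $\bar P_m=\frac14\mathrm{Tr}(\hat E_m)$ and let $\hat\omega_m=\hat E_m/(4\bar P_m)$ be the associated two-qubit POVM state on $\bar a a$, with reduced Bloch vectors $\boldsymbol\omega_m^{\bar a},\boldsymbol\omega_m^{a}$ and correlation matrix $w_m=(\mathrm{Tr}(\hat\omega_m\,\hat\sigma_i\otimes\hat\sigma_j))_{ij}$ (first index for $\bar a$, second for $a$). 3. For each $m$, a unitary $\hat U_m$ on qubit $b$, with associated rotation matrix $R_m\in SO(3)$ defined by $\hat U_m\,\mathbf n^\top\hat{\boldsymbol\sigma}\,\hat U_m^\dagger=(R_m\mathbf n)^\top\hat{\boldsymbol\sigma}$ for $\mathbf n\in\mathbb R^3$. For an input state $\hat\rho^{\mathrm{in}}=\frac12(\hat 1+\mathbf t^\top\hat{\boldsymbol\sigma})$ of qubit $\bar a$, $\|\mathbf t\|\le1$, the POVM is measured on $\bar a a$ in the state $\hat\rho^{\mathrm{in}}\otimes\hat\rho^{ab}$. Outcome $m$ has probability $P_m=P_m(\mathbf t)=\bar P_m g_m(\mathbf t)$ with $g_m(\mathbf t)=1+(\boldsymbol\omega_m^a)^\top\mathbf r^a+(w_m\mathbf r^a+\boldsymbol\omega_m^{\bar a})^\top\mathbf t$. When $P_m>0$, after application of $\hat U_m$ to qubit $b$ the output state is $\hat\rho_m^{\mathrm{out}}=\frac12(\hat 1+\mathbf t_m^\top\hat{\boldsymbol\sigma})$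 with $\mathbf t_m=R_m\,\dfrac{\mathbb a_m\mathbf t+\boldsymbol\kappa_m}{g_m(\mathbf t)}$, where $\mathbb a_m=\mathbf r^b(\boldsymbol\omega_m^{\bar a})^\top+r^\top w_m^\top$ and $\boldsymbol\kappa_m=\mathbf r^b+r^\top\boldsymbol\omega_m^a$. Conditions on $\mathbf t_m$ are understood whenever $P_m(\mathbf t)>0$. For a distinguishability measure $D$ between states, put $\bar D(\mathbf t)=\sum_m P_m(\mathbf t)\,D(\hat\rho^{\mathrm{in}},\hat\rho^{\mathrm{out}}_m)$ (terms with $P_m(\mathbf t)=0$ are zero), and let $\langle\bar D\rangle=\frac1{4\pi}\int_{S^2}\bar D(\mathbf t)\,d\Omega$ be the average over pure inputs, i.e. over unit vectors $\mathbf t$ with the uniform measure. $\langle\bar D_{\mathrm T}\rangle$ is obtained with the trace distance $D_{\mathrm T}(\hat\rho,\hat\sigma)=\frac12\mathrm{Tr}|\hat\rho-\hat\sigma|$, so that $D_{\mathrm T}(\hat\rho^{\mathrm{in}},\hat\rho^{\mathrm{out}}_m)=\frac12\|\mathbf t-\mathbf t_m\|$. $\langle\bar F\rangle$ is obtained with the fidelity $F(\hat\rho,\hat\sigma)=(\mathrm{Tr}\sqrt{\sqrt{\hat\rho}\,\hat\sigma\sqrt{\hat\rho}})^2$, so that $F(\hat\rho^{\mathrm{in}},\hat\rho_m^{\mathrm{out}})=\frac12(1+\mathbf t^\top\mathbf t_m+\sqrt{1-\|\mathbf t\|^2}\sqrt{1-\|\mathbf t_m\|^2})$. *)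

theory Defs
  imports "HOL-Analysis.Analysis"
begin

section \<open>Operators on finite-dimensional Hilbert spaces\<close>

definition dagger :: "complex^'n^'m \<Rightarrow> complex^'m^'n" where
  "dagger A = (\<chi> i j. cnj (A $ j $ i))"

definition psd :: "complex^'n^'n \<Rightarrow> bool" where
  "psd A \<longleftrightarrow> dagger A = A \<and>
     (\<forall>v :: complex^'n. 0 \<le> Re (\<Sum>i\<in>UNIV. cnj (v $ i) * (A *v v) $ i))"

definition density_op :: "complex^'n^'n \<Rightarrow> bool" where
  "density_op A \<longleftrightarrow> psd A \<and> trace A = 1"

definition unitary :: "complex^'n^'n \<Rightarrow> bool" where
  "unitary A \<longleftrightarrow> A ** dagger A = mat 1 \<and> dagger A ** A = mat 1"

text \<open>The unique positive semidefinite square root; only meaningful for positive semidefinite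
  arguments.\<close>

definition op_sqrt :: "complex^'n^'n \<Rightarrow> complex^'n^'n" where
  "op_sqrt A = (THE B. psd B \<and> B ** B = A)"

definition op_abs :: "complex^'n^'n \<Rightarrow> complex^'n^'n" where
  "op_abs A = op_sqrt (dagger A ** A)"

definition trace_distance :: "complex^'n^'n \<Rightarrow> complex^'n^'n \<Rightarrow> real" where
  "trace_distance A B = Re (trace (op_abs (A - B))) / 2"

definition fidelity :: "complex^'n^'n \<Rightarrow> complex^'n^'n \<Rightarrow> real" where
  "fidelity A B = (Re (trace (op_sqrt (op_sqrt A ** B ** op_sqrt A))))\<^sup>2"

definition tensor ::
  "complex^'n^'n \<Rightarrow> complex^'m^'m \<Rightarrow> complex^('n \<times> 'm)^('n \<times> 'm)" (infixr "\<otimes>\<^sub>o" 75) where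
  "A \<otimes>\<^sub>o B = (\<chi> p q. A $ fst p $ fst q * B $ snd p $ snd q)"


section \<open>Qubits\<close>

type_synonym qubit_op = "complex^2^2"
type_synonym qubit2_op = "complex^(2 \<times> 2)^(2 \<times> 2)"

text \<open>Three-qubit operators are indexed by \<open>2 \<times> (2 \<times> 2)\<close>, in the order input qubit, then
  the two qubits of the resource.\<close>

type_synonym qubit3_op = "complex^(2 \<times> 2 \<times> 2)^(2 \<times> 2 \<times> 2)"

definition pauli :: "3 \<Rightarrow> qubit_op" where
  "pauli k =
    (if k = 1 then vector [vector [0, 1], vector [1, 0]]
     else if k = 2 then vector [vector [0, - \<i>], vector [\<i>, 0]]
     else vector [vector [1, 0], vector [0, - 1]])"

definition sigma_dot :: "real^3 \<Rightarrow> qubit_op" where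
  "sigma_dot n = (\<Sum>k\<in>UNIV. n $ k *\<^sub>R pauli k)"

definition bloch_state :: "real^3 \<Rightarrow> qubit_op" where
  "bloch_state t = (1/2) *\<^sub>R (mat 1 + sigma_dot t)"

definition bloch_vector :: "qubit_op \<Rightarrow> real^3" where
  "bloch_vector \<rho> = (\<chi> k. Re (trace (\<rho> ** pauli k)))"

text \<open>\<open>E \<otimes> 1\<close> for an operator \<open>E\<close> on the first two of three qubits. This is not literally
  \<open>tensor E (mat 1)\<close> because of the bracketing of the index type.\<close>

definition on_first_two :: "qubit2_op \<Rightarrow> qubit3_op" where
  "on_first_two E = (\<chi> p q. E $ (fst p, fst (snd p)) $ (fst q, fst (snd q)) *
     (mat 1 :: qubit_op) $ snd (snd p) $ snd (snd q))"

definition ptrace_first_two :: "qubit3_op \<Rightarrow> qubit_op" where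
  "ptrace_first_two A = (\<chi> k l. \<Sum>i\<in>UNIV. \<Sum>j\<in>UNIV. A $ (i, j, k) $ (i, j, l))"


section \<open>Quantum teleportation protocols\<close>

text \<open>The POVM is a family indexed by the set \<open>outcomes\<close>; the values of \<open>effect\<close> and
  \<open>correction\<close> outside of that set are irrelevant.\<close>

record 'm qtp =
  resource :: qubit2_op
  outcomes :: "'m set"
  effect :: "'m \<Rightarrow> qubit2_op"
  correction :: "'m \<Rightarrow> qubit_op"

definition is_qtp :: "'m qtp \<Rightarrow> bool" where
  "is_qtp Q \<longleftrightarrow>
     density_op (resource Q) \<and>
     finite (outcomes Q) \<and>
     (\<forall>m\<in>outcomes Q. psd (effect Q m) \<and> effect Q m \<noteq> 0) \<and>
     (\<Sum>m\<in>outcomes Q. effect Q m) = mat 1 \<and>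
     (\<forall>m\<in>outcomes Q. unitary (correction Q m))"

text \<open>The operator \<open>(E\<^sub>m \<otimes> 1) (\<rho>\<^sup>i\<^sup>n \<otimes> \<rho>\<^sup>a\<^sup>b)\<close>: its trace is the Born probability of outcome
  \<open>m\<close>, and its partial trace over the measured pair is the unnormalised conditional state of
  the remaining qubit.\<close>

definition measured :: "'m qtp \<Rightarrow> 'm \<Rightarrow> real^3 \<Rightarrow> qubit3_op" where
  "measured Q m t = on_first_two (effect Q m) ** (bloch_state t \<otimes>\<^sub>o resource Q)"

definition outcome_prob :: "'m qtp \<Rightarrow> 'm \<Rightarrow> real^3 \<Rightarrow> real" where
  "outcome_prob Q m t = Re (trace (measured Q m t))"

text \<open>Only meaningful if \<^term>\<open>outcome_prob Q m t > 0\<close>.\<close>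

definition output_state :: "'m qtp \<Rightarrow> 'm \<Rightarrow> real^3 \<Rightarrow> qubit_op" where
  "output_state Q m t = (1 / outcome_prob Q m t) *\<^sub>R
     (correction Q m ** ptrace_first_two (measured Q m t) ** dagger (correction Q m))"

text \<open>Terms with vanishing probability contribute zero.\<close>

definition mean_over_outcomes ::
  "(qubit_op \<Rightarrow> qubit_op \<Rightarrow> real) \<Rightarrow> 'm qtp \<Rightarrow> real^3 \<Rightarrow> real" where
  "mean_over_outcomes D Q t =
     (\<Sum>m\<in>outcomes Q. outcome_prob Q m t * D (bloch_state t) (output_state Q m t))"

definition sphere_point :: "real \<Rightarrow> real \<Rightarrow> real^3" where
  "sphere_point \<theta> \<phi> = vector [sin \<theta> * cos \<phi>, sin \<theta> * sin \<phi>, cos \<theta>]"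

text \<open>The uniform average over the unit sphere, with \<open>d\<Omega> = sin \<theta> d\<theta> d\<phi>\<close>.\<close>

definition sphere_average :: "(real^3 \<Rightarrow> real) \<Rightarrow> real" where
  "sphere_average f = 1 / (4 * pi) *
     (LINT x:{0..pi} \<times> {0..2 * pi}|lborel. f (sphere_point (fst x) (snd x)) * sin (fst x))"

definition average_over_inputs ::
  "(qubit_op \<Rightarrow> qubit_op \<Rightarrow> real) \<Rightarrow> 'm qtp \<Rightarrow> real" where
  "average_over_inputs D Q = sphere_average (mean_over_outcomes D Q)"

definition aligned_with :: "'m qtp \<Rightarrow> ('m \<Rightarrow> real) \<Rightarrow> bool" where
  "aligned_with Q s \<longleftrightarrow> (\<forall>m\<in>outcomes Q. 0 < s m \<and> s m \<le> 1 \<and>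
     (\<forall>t. norm t \<le> 1 \<longrightarrow> outcome_prob Q m t > 0 \<longrightarrow>
        bloch_vector (output_state Q m t) = s m *\<^sub>R t))"


section \<open>The protocol in terms of Bloch vectors\<close>

text \<open>The operator-level definitions above imply the usual expressions for the outcome
  probabilities and for the Bloch vectors of the output states: see \<open>outcome_prob_eq\<close> and
  \<open>output_state_eq\<close>.\<close>

text \<open>Reduced Bloch vectors and correlation matrix of a two-qubit operator, i.e. the coefficients
  of its Fano form.\<close>

definition bloch_first :: "qubit2_op \<Rightarrow> real^3" where
  "bloch_first A = (\<chi> i. Re (trace (A ** (pauli i \<otimes>\<^sub>o mat 1))))"

definition bloch_second :: "qubit2_op \<Rightarrow> real^3" where
  "bloch_second A = (\<chi> i. Re (trace (A ** (mat 1 \<otimes>\<^sub>o pauli i))))"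

definition correlation_matrix :: "qubit2_op \<Rightarrow> real^3^3" where
  "correlation_matrix A = (\<chi> i j. Re (trace (A ** (pauli i \<otimes>\<^sub>o pauli j))))"

definition povm_weight :: "qubit2_op \<Rightarrow> real" where
  "povm_weight E = Re (trace E) / 4"

definition povm_state :: "qubit2_op \<Rightarrow> qubit2_op" where
  "povm_state E = (1 / (4 * povm_weight E)) *\<^sub>R E"

definition prob_factor :: "qubit2_op \<Rightarrow> qubit2_op \<Rightarrow> real^3 \<Rightarrow> real" where
  "prob_factor \<omega> \<rho> t = 1 + bloch_second \<omega> \<bullet> bloch_first \<rho> +
     (correlation_matrix \<omega> *v bloch_first \<rho> + bloch_first \<omega>) \<bullet> t"

lemma sum_prod_UNIV: "sum f (UNIV :: ('a::finite \<times> 'b::finite) set) = (\<Sum>i\<in>UNIV. \<Sum>j\<in>UNIV. f (i, j))"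
  using sum.cartesian_product[of "\<lambda>i j. f (i, j)" UNIV UNIV] by simp

lemma herm_entry: assumes "dagger A = A" shows "A $ i $ j = cnj (A $ j $ i)"
  using arg_cong[OF assms, of "\<lambda>B. B $ i $ j"] by (simp add: dagger_def)

lemma mat1_entries: "(mat 1 :: qubit_op) $ 1 $ 1 = 1" "(mat 1 :: qubit_op) $ 1 $ 2 = 0"
  "(mat 1 :: qubit_op) $ 2 $ 1 = 0" "(mat 1 :: qubit_op) $ 2 $ 2 = 1"
  by (simp_all add: mat_def)

lemma pauli_entries:
  "pauli 1 $ 1 $ 1 = 0" "pauli 1 $ 1 $ 2 = 1" "pauli 1 $ 2 $ 1 = 1" "pauli 1 $ 2 $ 2 = 0"
  "pauli 2 $ 1 $ 1 = 0" "pauli 2 $ 1 $ 2 = - \<i>" "pauli 2 $ 2 $ 1 = \<i>" "pauli 2 $ 2 $ 2 = 0"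
  "pauli 3 $ 1 $ 1 = 1" "pauli 3 $ 1 $ 2 = 0" "pauli 3 $ 2 $ 1 = 0" "pauli 3 $ 2 $ 2 = -1"
  by (simp_all add: pauli_def)

lemma trace_prod_tensor:
  "trace (A ** (B \<otimes>\<^sub>o C)) = (\<Sum>i\<in>UNIV. \<Sum>j\<in>UNIV. \<Sum>k\<in>UNIV. \<Sum>l\<in>UNIV. A $ (i,j) $ (k,l) * (B $ k $ i * C $ l $ j))"
  by (simp add: trace_def matrix_matrix_mult_def tensor_def sum_prod_UNIV)

lemma ptrace_measured:
  "2 *\<^sub>R ptrace_first_two (on_first_two E ** (bloch_state t \<otimes>\<^sub>o \<sigma>)) $ k $ l =
     (\<Sum>i\<in>UNIV. \<Sum>j\<in>UNIV. \<Sum>i'\<in>UNIV. \<Sum>j'\<in>UNIV.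
        E $ (i,j) $ (i',j') * ((mat 1 + sigma_dot t) $ i' $ i * \<sigma> $ (j',k) $ (j,l)))"
proof -
  have *: "(\<Sum>k'\<in>UNIV. e * (mat 1 :: qubit_op) $ k $ k' * f k') = e * f k" for e :: complex and f
    using exhaust_2[of k] by (auto simp: sum_2 mat1_entries)
  have half: "bloch_state t $ i $ j = (1/2) * (mat 1 + sigma_dot t) $ i $ j" for i j
    by (simp add: bloch_state_def complex_eq_iff)
  have "ptrace_first_two (on_first_two E ** (bloch_state t \<otimes>\<^sub>o \<sigma>)) $ k $ l =
     (\<Sum>i\<in>UNIV. \<Sum>j\<in>UNIV. \<Sum>i'\<in>UNIV. \<Sum>j'\<in>UNIV.
        E $ (i,j) $ (i',j') * (bloch_state t $ i' $ i * \<sigma> $ (j',k) $ (j,l)))"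
    by (simp add: ptrace_first_two_def on_first_two_def matrix_matrix_mult_def tensor_def sum_prod_UNIV *)
  then show ?thesis
    unfolding half by (simp add: sum_distrib_left scaleR_conv_of_real del: vector_add_component)
qed

lemma trace_measured: "trace (A :: qubit3_op) = trace (ptrace_first_two A)"
  by (simp add: trace_def ptrace_first_two_def sum_prod_UNIV sum_2 algebra_simps)

lemma sigma_dot_entries:
  "sigma_dot t $ 1 $ 1 = Complex (t $ 3) 0"
  "sigma_dot t $ 1 $ 2 = Complex (t $ 1) (- t $ 2)"
  "sigma_dot t $ 2 $ 1 = Complex (t $ 1) (t $ 2)"
  "sigma_dot t $ 2 $ 2 = Complex (- t $ 3) 0"
  by (simp_all add: sigma_dot_def sum_3 pauli_entries complex_eq_iff)

lemma herm_offdiag: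
  fixes A :: qubit2_op
  assumes "dagger A = A"
  shows "A $ (1,2) $ (1,1) = cnj (A $ (1,1) $ (1,2))" "A $ (2,1) $ (1,1) = cnj (A $ (1,1) $ (2,1))"
    "A $ (2,2) $ (1,1) = cnj (A $ (1,1) $ (2,2))" "A $ (2,1) $ (1,2) = cnj (A $ (1,2) $ (2,1))"
    "A $ (2,2) $ (1,2) = cnj (A $ (1,2) $ (2,2))" "A $ (2,2) $ (2,1) = cnj (A $ (2,1) $ (2,2))"
  by (rule herm_entry[OF assms])+

lemma herm_diag:
  fixes A :: "complex^'n^'n"
  assumes "dagger A = A"
  shows "Im (A $ p $ p) = 0"
  using herm_entry[OF assms, of p p] by (simp add: complex_eq_iff)

lemma bloch_first_entries: assumes "dagger A = A" shows
  "bloch_first A $ 1 = 2 * Re (A $ (1,1) $ (2,1)) + 2 * Re (A $ (1,2) $ (2,2))"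
  "bloch_first A $ 2 = - 2 * Im (A $ (1,1) $ (2,1)) - 2 * Im (A $ (1,2) $ (2,2))"
  "bloch_first A $ 3 = Re (A $ (1,1) $ (1,1)) + Re (A $ (1,2) $ (1,2)) - Re (A $ (2,1) $ (2,1)) - Re (A $ (2,2) $ (2,2))"
  by (simp_all add: bloch_first_def trace_prod_tensor sum_2 pauli_entries mat1_entries herm_offdiag[OF assms])

lemma bloch_second_entries: assumes "dagger A = A" shows
  "bloch_second A $ 1 = 2 * Re (A $ (1,1) $ (1,2)) + 2 * Re (A $ (2,1) $ (2,2))"
  "bloch_second A $ 2 = - 2 * Im (A $ (1,1) $ (1,2)) - 2 * Im (A $ (2,1) $ (2,2))"
  "bloch_second A $ 3 = Re (A $ (1,1) $ (1,1)) - Re (A $ (1,2) $ (1,2)) + Re (A $ (2,1) $ (2,1)) - Re (A $ (2,2) $ (2,2))"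
  by (simp_all add: bloch_second_def trace_prod_tensor sum_2 pauli_entries mat1_entries herm_offdiag[OF assms])

lemma correlation_entries: assumes "dagger A = A" shows
  "correlation_matrix A $ 1 $ 1 = 2 * Re (A $ (1,1) $ (2,2)) + 2 * Re (A $ (1,2) $ (2,1))"
  "correlation_matrix A $ 1 $ 2 = - 2 * Im (A $ (1,1) $ (2,2)) + 2 * Im (A $ (1,2) $ (2,1))"
  "correlation_matrix A $ 1 $ 3 = 2 * Re (A $ (1,1) $ (2,1)) - 2 * Re (A $ (1,2) $ (2,2))"
  "correlation_matrix A $ 2 $ 1 = - 2 * Im (A $ (1,1) $ (2,2)) - 2 * Im (A $ (1,2) $ (2,1))"
  "correlation_matrix A $ 2 $ 2 = - 2 * Re (A $ (1,1) $ (2,2)) + 2 * Re (A $ (1,2) $ (2,1))"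
  "correlation_matrix A $ 2 $ 3 = - 2 * Im (A $ (1,1) $ (2,1)) + 2 * Im (A $ (1,2) $ (2,2))"
  "correlation_matrix A $ 3 $ 1 = 2 * Re (A $ (1,1) $ (1,2)) - 2 * Re (A $ (2,1) $ (2,2))"
  "correlation_matrix A $ 3 $ 2 = - 2 * Im (A $ (1,1) $ (1,2)) + 2 * Im (A $ (2,1) $ (2,2))"
  "correlation_matrix A $ 3 $ 3 = Re (A $ (1,1) $ (1,1)) - Re (A $ (1,2) $ (1,2)) - Re (A $ (2,1) $ (2,1)) + Re (A $ (2,2) $ (2,2))"
  by (simp_all add: correlation_matrix_def trace_prod_tensor sum_2 pauli_entries mat1_entries herm_offdiag[OF assms])

lemma trace_entries: "Re (trace (A::qubit2_op)) = Re (A $ (1,1) $ (1,1)) + Re (A $ (1,2) $ (1,2)) + Re (A $ (2,1) $ (2,1)) + Re (A $ (2,2) $ (2,2))"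
  by (simp add: trace_def sum_prod_UNIV sum_2)

lemma psd_trace_pos:
  fixes A :: "complex^'n^'n"
  assumes "psd A" "A \<noteq> 0"
  shows "Re (trace A) > 0"
proof -
  have herm: "dagger A = A" using assms by (simp add: psd_def)
  have quad: "0 \<le> Re (cnj x * (A $ i $ i * x + A $ i $ j * y) + cnj y * (A $ j $ i * x + A $ j $ j * y))"
    for i j x y
  proof -
    define v :: "complex^'n" where "v = (\<chi> k. (if k = i then x else 0) + (if k = j then y else 0))"
    have Av: "(A *v v) $ k = A $ k $ i * x + A $ k $ j * y" for k
    proof -
      have "(A *v v) $ k = (\<Sum>l\<in>UNIV. (if l = i then A $ k $ i * x else 0) + (if l = j then A $ k $ j * y else 0))"
        unfolding matrix_vector_mult_def v_def vec_lambda_beta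
        by (rule sum.cong) (auto simp: distrib_left)
      then show ?thesis by (simp add: sum.distrib)
    qed
    have "(\<Sum>k\<in>UNIV. cnj (v $ k) * (A *v v) $ k) =
        (\<Sum>k\<in>UNIV. (if k = i then cnj x * (A *v v) $ k else 0) + (if k = j then cnj y * (A *v v) $ k else 0))"
      by (rule sum.cong) (auto simp: v_def distrib_right)
    also have "\<dots> = cnj x * (A *v v) $ i + cnj y * (A *v v) $ j"
      by (simp add: sum.distrib)
    finally show ?thesis
      using assms(1)[unfolded psd_def, THEN conjunct2, rule_format, of v] unfolding Av by simp
  qed
  have diag: "0 \<le> Re (A $ i $ i)" for i
    using quad[where i=i and x=1 and j=i and y=0] by simp
  have tr: "Re (trace A) = (\<Sum>i\<in>UNIV. Re (A $ i $ i))" by (simp add: trace_def)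
  show ?thesis
  proof (rule ccontr)
    assume "\<not> ?thesis"
    moreover have "Re (trace A) \<ge> 0" unfolding tr by (intro sum_nonneg diag)
    ultimately have "(\<Sum>i\<in>UNIV. Re (A $ i $ i)) = 0" using tr by linarith
    then have d0: "Re (A $ i $ i) = 0" for i
      using diag by (subst (asm) sum_nonneg_eq_0_iff) auto
    have "A $ i $ j = 0" for i j
    proof -
      define z where "z = A $ i $ j"
      have "A $ j $ i = cnj z" "Re (A $ i $ i) = 0" "Im (A $ i $ i) = 0" "Re (A $ j $ j) = 0" "Im (A $ j $ j) = 0"
        using herm_entry[OF herm, of j i] herm_entry[OF herm, of i i] herm_entry[OF herm, of j j] d0
        by (simp_all add: z_def complex_eq_iff)
      then have "0 \<le> - 2 * ((Re z)\<^sup>2 + (Im z)\<^sup>2)"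
        using quad[where i=i and j=j and x="- z" and y=1] by (simp add: z_def[symmetric] power2_eq_square)
      then have "(Re z)\<^sup>2 + (Im z)\<^sup>2 \<le> 0"
        by (simp only: mult_le_0_iff zero_le_mult_iff) simp
      then show ?thesis by (simp add: z_def[symmetric] complex_eq_iff sum_power2_le_zero_iff)
    qed
    then have "A = 0" by (simp add: vec_eq_iff)
    with assms show False by simp
  qed
qed

lemma conditional_state_eq:
  fixes E \<rho> :: qubit2_op and t :: "real^3"
  assumes E: "dagger E = E" and \<rho>: "dagger \<rho> = \<rho>"
  defines "p \<equiv> Re (trace E) * Re (trace \<rho>) + bloch_second E \<bullet> bloch_first \<rho> +
     (correlation_matrix E *v bloch_first \<rho> + Re (trace \<rho>) *\<^sub>R bloch_first E) \<bullet> t"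
  defines "x \<equiv> (bloch_first E \<bullet> t) *\<^sub>R bloch_second \<rho> +
     transpose (correlation_matrix \<rho>) *v (transpose (correlation_matrix E) *v t)
     + Re (trace E) *\<^sub>R bloch_second \<rho> + transpose (correlation_matrix \<rho>) *v bloch_second E"
  shows "8 *\<^sub>R ptrace_first_two (on_first_two E ** (bloch_state t \<otimes>\<^sub>o \<rho>)) =
     p *\<^sub>R mat 1 + sigma_dot x"
proof -
  have scaleR8: "8 *\<^sub>R A = 4 *\<^sub>R 2 *\<^sub>R A" for A :: qubit_op by simp
  note entries = bloch_first_entries bloch_second_entries correlation_entries
  show ?thesis
    unfolding vec_eq_iff forall_2 scaleR8
    apply (simp only: vector_scaleR_component vector_add_component sigma_dot_entries mat1_entries ptrace_measured sum_2
      herm_offdiag[OF E] herm_offdiag[OF \<rho>])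
    apply (simp add: complex_eq_iff p_def x_def inner_vec_def sum_3 matrix_vector_mult_def transpose_def
      trace_entries entries[OF E] entries[OF \<rho>] herm_diag[OF E] herm_diag[OF \<rho>])
    apply (simp add: algebra_simps)
    done
qed

lemma conditional_state_povm_state:
  fixes t :: "real^3"
  assumes E: "psd E" "E \<noteq> 0" and \<rho>: "density_op \<rho>"
  defines "\<omega> \<equiv> povm_state E"
  defines "x \<equiv> ((\<chi> i j. bloch_second \<rho> $ i * bloch_first \<omega> $ j)
       + transpose (correlation_matrix \<rho>) ** transpose (correlation_matrix \<omega>)) *v t
     + (bloch_second \<rho> + transpose (correlation_matrix \<rho>) *v bloch_second \<omega>)"
  shows "ptrace_first_two (on_first_two E ** (bloch_state t \<otimes>\<^sub>o \<rho>)) =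
     (povm_weight E / 2) *\<^sub>R (prob_factor \<omega> \<rho> t *\<^sub>R mat 1 + sigma_dot x)"
proof -
  have hE: "dagger E = E" using E by (simp add: psd_def)
  have h\<rho>: "dagger \<rho> = \<rho>" "trace \<rho> = 1" using \<rho> by (simp_all add: density_op_def psd_def)
  define c where "c = Re (trace E)"
  have c: "c > 0" unfolding c_def by (rule psd_trace_pos[OF E])
  have tr: "Re (trace (r *\<^sub>R A ** B)) = r * Re (trace (A ** B))" for r and A B :: qubit2_op
    by (simp add: trace_def matrix_matrix_mult_def scaleR_sum_right[symmetric] sum_distrib_left)
  have E_\<omega>: "E = c *\<^sub>R \<omega>" using c by (simp add: \<omega>_def povm_state_def povm_weight_def c_def)
  have b1: "bloch_first E = c *\<^sub>R bloch_first \<omega>"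
    unfolding E_\<omega> by (simp add: bloch_first_def vec_eq_iff tr)
  have b2: "bloch_second E = c *\<^sub>R bloch_second \<omega>"
    unfolding E_\<omega> by (simp add: bloch_second_def vec_eq_iff tr)
  have b3: "correlation_matrix E = c *\<^sub>R correlation_matrix \<omega>"
    unfolding E_\<omega> by (simp add: correlation_matrix_def vec_eq_iff tr)
  have outer: "(\<chi> i j. u $ i * v $ j) *v t = (v \<bullet> t) *\<^sub>R u" for u v :: "real^3"
    by (simp add: vec_eq_iff matrix_vector_mult_def inner_vec_def sum_distrib_left mult_ac)
  have transp: "transpose (r *\<^sub>R M) = r *\<^sub>R transpose M" for r and M :: "real^3^3"
    by (simp add: vec_eq_iff transpose_def)
  note lin = scaleR_matrix_vector_assoc[symmetric] matrix_vector_mult_scaleR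
  have "8 *\<^sub>R ptrace_first_two (on_first_two E ** (bloch_state t \<otimes>\<^sub>o \<rho>)) =
      (c * prob_factor \<omega> \<rho> t) *\<^sub>R mat 1 + sigma_dot (c *\<^sub>R x)"
    unfolding conditional_state_eq[OF hE h\<rho>(1)] c_def[symmetric] b1 b2 b3
    unfolding x_def matrix_vector_mult_add_rdistrib outer
    by (simp add: h\<rho>(2) prob_factor_def transp lin matrix_vector_mul_assoc[symmetric] algebra_simps)
  also have "\<dots> = c *\<^sub>R (prob_factor \<omega> \<rho> t *\<^sub>R mat 1 + sigma_dot x)"
    by (simp add: sigma_dot_def scaleR_sum_right scaleR_add_right)
  finally have "(1/8) *\<^sub>R 8 *\<^sub>R ptrace_first_two (on_first_two E ** (bloch_state t \<otimes>\<^sub>o \<rho>)) =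
      (1/8) *\<^sub>R c *\<^sub>R (prob_factor \<omega> \<rho> t *\<^sub>R mat 1 + sigma_dot x)" by (rule arg_cong)
  then show ?thesis by (simp add: povm_weight_def c_def)
qed

lemma trace_sigma_dot: "trace (sigma_dot x) = 0"
  by (simp add: trace_def sum_2 sigma_dot_entries complex_eq_iff)

lemma trace_scaleR: "trace (r *\<^sub>R A) = r *\<^sub>R trace (A :: qubit_op)"
  by (simp add: trace_def scaleR_sum_right)

theorem outcome_prob_eq:
  assumes "is_qtp Q" "m \<in> outcomes Q"
  shows "outcome_prob Q m t =
    povm_weight (effect Q m) * prob_factor (povm_state (effect Q m)) (resource Q) t"
proof -
  have *: "psd (effect Q m)" "effect Q m \<noteq> 0" "density_op (resource Q)"
    using assms by (auto simp: is_qtp_def)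
  have "trace (mat 1 :: qubit_op) = 2" by (simp add: trace_def sum_2 mat1_entries)
  then show ?thesis
    unfolding outcome_prob_def measured_def trace_measured conditional_state_povm_state[OF *]
    by (simp add: trace_scaleR trace_add trace_sigma_dot)
qed

theorem output_state_eq:
  fixes R :: "real^3^3"
  assumes "is_qtp Q" "m \<in> outcomes Q" "outcome_prob Q m t > 0"
    and R: "\<And>n. correction Q m ** sigma_dot n ** dagger (correction Q m) = sigma_dot (R *v n)"
  defines "\<omega> \<equiv> povm_state (effect Q m)" and "\<rho> \<equiv> resource Q"
  defines "a \<equiv> (\<chi> i j. bloch_second \<rho> $ i * bloch_first \<omega> $ j)
       + transpose (correlation_matrix \<rho>) ** transpose (correlation_matrix \<omega>)"
    and "\<kappa> \<equiv> bloch_second \<rho> + transpose (correlation_matrix \<rho>) *v bloch_second \<omega>"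
  shows "output_state Q m t = bloch_state (R *v ((1 / prob_factor \<omega> \<rho> t) *\<^sub>R (a *v t + \<kappa>)))"
proof -
  have *: "psd (effect Q m)" "effect Q m \<noteq> 0" "density_op (resource Q)"
    and U: "correction Q m ** dagger (correction Q m) = mat 1"
    using assms by (auto simp: is_qtp_def unitary_def)
  define P where "P = povm_weight (effect Q m)"
  define g where "g = prob_factor \<omega> \<rho> t"
  have prob: "outcome_prob Q m t = P * g"
    using outcome_prob_eq[OF assms(1,2)] by (simp add: P_def g_def \<omega>_def \<rho>_def)
  have nz: "P \<noteq> 0" "g \<noteq> 0" using assms(3) prob by auto
  have l: "A ** (r *\<^sub>R B) = r *\<^sub>R (A ** B)" "(r *\<^sub>R B) ** A = r *\<^sub>R (B ** A)" for r and A B :: qubit_op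
    by (simp_all add: vec_eq_iff matrix_matrix_mult_def scaleR_sum_right)
  have d: "(A + B) ** C = A ** C + B ** C" for A B C :: qubit_op
    by (simp add: vec_eq_iff matrix_matrix_mult_def distrib_right sum.distrib)
  have s: "sigma_dot (r *\<^sub>R n) = r *\<^sub>R sigma_dot n" for r n
    by (simp add: sigma_dot_def scaleR_sum_right)
  have "output_state Q m t = (1 / (P * g)) *\<^sub>R (P / 2) *\<^sub>R (g *\<^sub>R mat 1 + sigma_dot (R *v (a *v t + \<kappa>)))"
    unfolding output_state_def prob measured_def conditional_state_povm_state[OF *]
    by (simp add: l matrix_add_ldistrib d U R P_def g_def \<omega>_def \<rho>_def a_def \<kappa>_def)
  also have "\<dots> = bloch_state (R *v ((1 / g) *\<^sub>R (a *v t + \<kappa>)))"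
    unfolding bloch_state_def matrix_vector_mult_scaleR s
    using nz by (simp add: scaleR_add_right)
  finally show ?thesis by (simp add: g_def)
qed

end

theory Submission
  imports Defs
begin

text \<open>For a pure input with Bloch vector \<open>t\<close> and an output with Bloch vector \<open>t\<^sub>m\<close>, Cauchy--Schwarz
  with the unit vector \<open>t\<close> gives \<open>norm (t - t\<^sub>m) \<ge> t \<bullet> (t - t\<^sub>m) = 1 - t \<bullet> t\<^sub>m\<close>, so the trace distance
  is at least one minus the fidelity, with equality if \<open>t\<^sub>m = s t\<close> and \<open>s \<le> 1\<close>. As the outcome
  probabilities sum to one, averaging over outcomes and inputs preserves both facts. The averages
  are Lebesgue integrals, with value zero for non-integrable functions, so integrability has to be
  established: multiplying by the outcome probability removes the denominator in \<open>t\<^sub>m\<close> and leaves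
  functions that are continuous on the sphere, since the unnormalised output state is positive
  semidefinite and therefore vanishes together with its trace.\<close>

section \<open>Positive semidefinite operators\<close>

lemma dagger_dagger [simp]: "dagger (dagger A) = A"
  by (simp add: dagger_def vec_eq_iff)

lemma dagger_mult: "dagger (A ** B) = dagger B ** dagger A"
  by (simp add: dagger_def matrix_matrix_mult_def vec_eq_iff mult.commute)

lemma dagger_add: "dagger (A + B) = dagger A + dagger B"
  by (simp add: dagger_def vec_eq_iff)

lemma dagger_diff: "dagger (A - B) = dagger A - dagger B"
  by (simp add: dagger_def vec_eq_iff)

lemma dagger_scaleR: "dagger (r *\<^sub>R A) = r *\<^sub>R dagger A"
  by (simp add: dagger_def vec_eq_iff)

lemma dagger_mat_1: "dagger (mat 1) = mat 1"
  by (simp add: dagger_def mat_def vec_eq_iff)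

lemma scaleR_mat_mult:
  fixes A :: "complex^'n^'m" and B :: "complex^'k^'n"
  shows "(r *\<^sub>R A) ** B = r *\<^sub>R (A ** B)" "A ** (r *\<^sub>R B) = r *\<^sub>R (A ** B)"
  by (simp_all add: vec_eq_iff matrix_matrix_mult_def scaleR_sum_right)

lemma mat_mult_add_left:
  fixes A B :: "complex^'n^'m"
  shows "(A + B) ** C = A ** C + B ** C"
  by (simp add: vec_eq_iff matrix_matrix_mult_def distrib_right sum.distrib)

lemma mat_mult_diff:
  fixes A B :: "complex^'n^'m"
  shows "(A - B) ** C = A ** C - B ** C" "D ** (A - B) = D ** A - D ** B"
  by (simp_all add: vec_eq_iff matrix_matrix_mult_def algebra_simps sum_subtractf)

lemma trace_mat_mult_commute:
  fixes A B :: "complex^'n^'n"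
  shows "trace (A ** B) = trace (B ** A)"
proof -
  have "trace (A ** B) = (\<Sum>i\<in>UNIV. \<Sum>k\<in>UNIV. A $ i $ k * B $ k $ i)"
    by (simp add: trace_def matrix_matrix_mult_def)
  also have "\<dots> = (\<Sum>k\<in>UNIV. \<Sum>i\<in>UNIV. B $ k $ i * A $ i $ k)"
    by (subst sum.swap) (simp add: mult.commute)
  also have "\<dots> = trace (B ** A)"
    by (simp add: trace_def matrix_matrix_mult_def)
  finally show ?thesis .
qed

lemma dagger_adjoint:
  fixes B :: "complex^'n^'m"
  shows "(\<Sum>i\<in>UNIV. cnj (v $ i) * (B *v u) $ i) = (\<Sum>j\<in>UNIV. cnj ((dagger B *v v) $ j) * u $ j)"
proof -
  have "(\<Sum>i\<in>UNIV. cnj (v $ i) * (B *v u) $ i) = (\<Sum>i\<in>UNIV. \<Sum>j\<in>UNIV. cnj (v $ i) * (B $ i $ j * u $ j))"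
    by (simp add: matrix_vector_mult_def sum_distrib_left)
  also have "\<dots> = (\<Sum>j\<in>UNIV. \<Sum>i\<in>UNIV. cnj (v $ i) * (B $ i $ j * u $ j))"
    by (rule sum.swap)
  also have "\<dots> = (\<Sum>j\<in>UNIV. cnj ((dagger B *v v) $ j) * u $ j)"
    by (simp add: matrix_vector_mult_def dagger_def sum_distrib_left sum_distrib_right mult_ac)
  finally show ?thesis .
qed

text \<open>The quadratic form of \<open>B ** A ** dagger B\<close> at \<open>v\<close> is that of
  \<open>A\<close> at \<open>dagger B *v v\<close>. Most positivity claims below are reduced to this
  one by exhibiting a congruence.\<close>

lemma psd_congruence:
  fixes A :: "complex^'n^'n" and B :: "complex^'n^'m"
  assumes "psd A"
  shows "psd (B ** A ** dagger B)"
proof -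
  have "dagger (B ** A ** dagger B) = B ** A ** dagger B"
    using assms by (simp add: dagger_mult psd_def matrix_mul_assoc)
  moreover have "(\<Sum>i\<in>UNIV. cnj (v $ i) * (B ** A ** dagger B *v v) $ i) =
      (\<Sum>j\<in>UNIV. cnj ((dagger B *v v) $ j) * (A *v (dagger B *v v)) $ j)" for v
    by (simp add: dagger_adjoint matrix_vector_mul_assoc[symmetric])
  ultimately show ?thesis using assms by (simp add: psd_def)
qed

lemma psd_mat_1: "psd (mat 1)"
  by (auto simp: psd_def dagger_mat_1 intro!: sum_nonneg)

lemma psd_mult_dagger: "psd (B ** dagger B)"
  using psd_congruence[OF psd_mat_1, of B] by simp

lemma psd_scaleR:
  assumes "psd A" "0 \<le> r"
  shows "psd (r *\<^sub>R A)"
proof -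
  have "(r *\<^sub>R A) *v v = r *\<^sub>R (A *v v)" for v
    by (simp add: vec_eq_iff matrix_vector_mult_def scaleR_sum_right)
  then show ?thesis
    using assms by (simp add: psd_def dagger_scaleR scaleR_sum_right[symmetric] del: Re_sum)
qed

lemma psd_zero: "psd 0"
  using psd_scaleR[OF psd_mat_1, of 0] by simp

lemma psd_add:
  assumes "psd A" "psd B"
  shows "psd (A + B)"
  using assms
  by (simp add: psd_def dagger_add matrix_vector_mult_add_rdistrib distrib_left sum.distrib
      add_nonneg_nonneg del: Re_sum)

lemma psd_sum: "(\<And>x. x \<in> S \<Longrightarrow> psd (f x)) \<Longrightarrow> psd (sum f S)"
  by (induction S rule: infinite_finite_induct) (auto simp: psd_zero psd_add)

lemma psd_trace_nonneg:
  assumes "psd A"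
  shows "0 \<le> Re (trace A)"
  using psd_trace_pos[OF assms] by (cases "A = 0") (auto simp: trace_def)

lemma psd_trace_eq_0: "psd A \<Longrightarrow> Re (trace A) = 0 \<Longrightarrow> A = 0"
  using psd_trace_pos[of A] by fastforce

section \<open>Uniqueness of the positive semidefinite square root\<close>

lemma mult_dagger_eq_0:
  assumes "A ** dagger A = 0"
  shows "A = 0"
proof -
  have "(\<Sum>j\<in>UNIV. (norm (A $ i $ j))\<^sup>2) = 0" for i
  proof -
    have "complex_of_real (\<Sum>j\<in>UNIV. (norm (A $ i $ j))\<^sup>2) = (A ** dagger A) $ i $ i"
      by (simp add: matrix_matrix_mult_def dagger_def flip: complex_norm_square)
    then show ?thesis by (simp add: assms del: of_real_sum)
  qed
  then show ?thesis
    by (simp add: vec_eq_iff sum_nonneg_eq_0_iff)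
qed

text \<open>With \<open>D = B - C\<close> one has \<open>B D + D C = 0\<close>, so the positive operators \<open>D B D\<close> and
  \<open>D C D\<close> have opposite traces and vanish; hence \<open>D\<^sup>3 = 0\<close>.\<close>

lemma psd_sqrt_unique:
  fixes B C :: "complex^'n^'n"
  assumes "psd B" "psd C" "B ** B = C ** C"
  shows "B = C"
proof -
  define D where "D = B - C"
  have hD: "dagger D = D"
    using assms by (simp add: D_def dagger_diff psd_def)
  have pB: "psd (D ** B ** D)" and pC: "psd (D ** C ** D)"
    using psd_congruence[OF assms(1), of D] psd_congruence[OF assms(2), of D] hD by simp_all
  have "B ** D + D ** C = 0"
    using assms(3) by (simp add: D_def mat_mult_diff)
  then have "D ** (B ** D + D ** C) = 0" by simp
  then have "trace (D ** B ** D) + trace (D ** (D ** C)) = 0"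
    by (simp add: matrix_add_ldistrib trace_add[symmetric] matrix_mul_assoc) (simp add: trace_def)
  moreover have "trace (D ** (D ** C)) = trace (D ** C ** D)"
    by (rule trace_mat_mult_commute)
  ultimately have "Re (trace (D ** B ** D)) + Re (trace (D ** C ** D)) = 0"
    by (metis plus_complex.sel(1) zero_complex.sel(1))
  then have "Re (trace (D ** B ** D)) = 0" "Re (trace (D ** C ** D)) = 0"
    using psd_trace_nonneg[OF pB] psd_trace_nonneg[OF pC] by linarith+
  then have "D ** B ** D = 0" "D ** C ** D = 0"
    using psd_trace_eq_0 pB pC by blast+
  then have "D ** D ** D = 0"
    by (simp add: D_def mat_mult_diff)
  \<comment> \<open>As \<open>D\<close> is Hermitian, this product is the fourth power of
    \<open>D\<close>. Cancelling the adjoint twice, first for \<open>D ** D\<close> and then for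
    \<open>D\<close>, gives \<open>D = 0\<close>.\<close>
  then have "(D ** D) ** dagger (D ** D) = 0"
    by (simp add: dagger_mult hD matrix_mul_assoc)
  then have "D ** dagger D = 0"
    using mult_dagger_eq_0 hD by metis
  then show ?thesis
    using mult_dagger_eq_0 D_def by fastforce
qed

text \<open>By uniqueness, any positive semidefinite root that is exhibited is the value of the
  definite description in \<open>op_sqrt\<close>. The roots exhibited later are multiples of the
  identity and of pure states.\<close>

lemma op_sqrt_eq: "psd B \<Longrightarrow> B ** B = A \<Longrightarrow> op_sqrt A = B"
  unfolding op_sqrt_def by (rule the_equality) (auto intro: psd_sqrt_unique)

section \<open>Decomposition of positive semidefinite operators into rank-one terms |w><w|\<close>

definition outer :: "complex^'n \<Rightarrow> complex^'n^'n" where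
  "outer w = (\<chi> i j. w $ i * cnj (w $ j))"

text \<open>Let z be the entry at \<open>(i, j)\<close>. On the vector with entries -z at
  \<open>i\<close> and a real r at \<open>j\<close>, the form equals r^2 d - 2 r |z|^2, where d is
  the diagonal entry at \<open>j\<close>. For small r > 0 this is negative unless z = 0.\<close>

lemma psd_zero_diag:
  assumes "psd A" "A $ i $ i = 0"
  shows "A $ i $ j = 0"
proof -
  have herm: "dagger A = A" using assms by (simp add: psd_def)
  have quad: "0 \<le> Re (cnj x * (A $ i $ i * x + A $ i $ j * y) + cnj y * (A $ j $ i * x + A $ j $ j * y))"
    if "i \<noteq> j" for x y
  proof -
    define v :: "complex^'a" where "v = (\<chi> k. (if k = i then x else 0) + (if k = j then y else 0))"
    have Av: "(A *v v) $ k = A $ k $ i * x + A $ k $ j * y" for k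
    proof -
      have "(A *v v) $ k =
          (\<Sum>l\<in>UNIV. (if l = i then A $ k $ i * x else 0) + (if l = j then A $ k $ j * y else 0))"
        unfolding matrix_vector_mult_def v_def vec_lambda_beta
        by (rule sum.cong) (auto simp: distrib_left)
      then show ?thesis by (simp add: sum.distrib)
    qed
    have "(\<Sum>k\<in>UNIV. cnj (v $ k) * (A *v v) $ k) =
        (\<Sum>k\<in>UNIV. (if k = i then cnj x * (A *v v) $ k else 0) + (if k = j then cnj y * (A *v v) $ k else 0))"
      by (rule sum.cong) (auto simp: v_def distrib_right)
    also have "\<dots> = cnj x * (A *v v) $ i + cnj y * (A *v v) $ j"
      by (simp add: sum.distrib)
    finally have "(\<Sum>k\<in>UNIV. cnj (v $ k) * (A *v v) $ k) =
        cnj x * (A $ i $ i * x + A $ i $ j * y) + cnj y * (A $ j $ i * x + A $ j $ j * y)"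
      by (simp add: Av)
    then show ?thesis
      using assms(1)[unfolded psd_def, THEN conjunct2, rule_format, of v] by metis
  qed
  show ?thesis
  proof (cases "i = j")
    case False
    define z where "z = A $ i $ j"
    define d where "d = Re (A $ j $ j)"
    have ji: "A $ j $ i = cnj z" by (simp add: z_def herm_entry[OF herm, of j i])
    have "0 \<le> r\<^sup>2 * d - 2 * r * ((Re z)\<^sup>2 + (Im z)\<^sup>2)" for r :: real
      using quad[OF False, of "- z" "of_real r"] assms(2)
      by (simp add: ji z_def[symmetric] d_def power2_eq_square algebra_simps)
    then have *: "2 * r * (norm z)\<^sup>2 \<le> r\<^sup>2 * d" for r :: real
      by (simp add: cmod_power2 algebra_simps)
    have "(norm z)\<^sup>2 \<le> 0"
    proof (rule ccontr)
      assume "\<not> (norm z)\<^sup>2 \<le> 0"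
      then have z: "(norm z)\<^sup>2 > 0" by simp
      \<comment> \<open>Chosen so that \<open>r * (\<bar>d\<bar> + 1)\<close> is exactly the squared
        norm of \<open>z\<close>; the summand 1 keeps the denominator positive when
        \<open>d = 0\<close>.\<close>
      define r where "r = (norm z)\<^sup>2 / (\<bar>d\<bar> + 1)"
      have r: "r > 0" using z by (simp add: r_def)
      have "2 * (norm z)\<^sup>2 \<le> r * d"
        using *[of r] r by (simp add: power2_eq_square)
      also have "\<dots> \<le> r * (\<bar>d\<bar> + 1)" using r by simp
      also have "\<dots> = (norm z)\<^sup>2" by (simp add: r_def)
      finally show False using z by simp
    qed
    then show ?thesis by (simp add: z_def)
  qed (use assms in simp)
qed

text \<open>One step of Cholesky elimination with pivot \<open>(i, i)\<close>:
  \<open>outer w\<close> has the same row and column \<open>i\<close> as \<open>A\<close>. The last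
  claim says that rows that are already zero stay zero, which lets the elimination be
  iterated.\<close>

lemma psd_schur_complement:
  assumes "psd A" "A $ i $ i \<noteq> 0"
  defines "w \<equiv> (1 / sqrt (Re (A $ i $ i))) *\<^sub>R (\<chi> k. A $ k $ i)"
  shows "psd (A - outer w)" "(A - outer w) $ i $ k = 0"
    "(\<And>l. A $ j $ l = 0) \<Longrightarrow> (A - outer w) $ j $ k = 0"
proof -
  have herm: "dagger A = A" using assms by (simp add: psd_def)
  define d where "d = Re (A $ i $ i)"
  have d: "A $ i $ i = complex_of_real d"
    using herm_diag[OF herm, of i] by (simp add: d_def complex_eq_iff)
  have quad: "0 \<le> Re (\<Sum>k\<in>UNIV. cnj (v $ k) * (A *v v) $ k)" for v
    using assms(1) by (simp add: psd_def)
  have "0 \<le> d"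
    using quad[of "axis i 1"]
    by (simp add: d_def axis_def matrix_vector_mult_def if_distrib if_distribR cong: if_cong)
  then have dpos: "d > 0" using assms(2) d by (cases "d = 0") auto
  have w: "outer w $ k $ l = A $ k $ i * A $ i $ l / d" for k l
  proof -
    have "outer w $ k $ l = (1 / sqrt d * (1 / sqrt d)) *\<^sub>R (A $ k $ i * cnj (A $ l $ i))"
      by (simp add: outer_def w_def d_def)
    also have "1 / sqrt d * (1 / sqrt d) = 1 / d" using dpos by simp
    finally show ?thesis
      using herm_entry[OF herm, of i l] by (simp add: scaleR_conv_of_real)
  qed
  show "(A - outer w) $ i $ k = 0"
    using dpos by (simp add: w d)
  show "(A - outer w) $ j $ k = 0" if "\<And>l. A $ j $ l = 0"
    using that by (simp add: w)
  \<comment> \<open>The elementary elimination matrix that subtracts multiples of row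
    \<open>i\<close> so as to clear column \<open>i\<close>. Then \<open>T ** A\<close> is the Schur
    complement, and multiplying by \<open>dagger T\<close> on the right changes nothing because
    column \<open>i\<close> is already zero. The complement is thus congruent to
    \<open>A\<close>.\<close>
  define T :: "complex^'a^'a" where
    "T = (\<chi> k l. (if k = l then 1 else 0) - (if l = i then A $ k $ i / d else 0))"
  have "(T ** A) $ k $ l = (A - outer w) $ k $ l" for k l
  proof -
    have "(T ** A) $ k $ l = (\<Sum>j\<in>UNIV. (if k = j then A $ k $ l else 0)
        - (if j = i then A $ k $ i / d * A $ i $ l else 0))"
      unfolding matrix_matrix_mult_def T_def vec_lambda_beta
      by (rule sum.cong) (auto simp: algebra_simps)
    then show ?thesis by (simp add: sum_subtractf w)
  qed
  then have AT: "A - outer w = T ** A" by (simp add: vec_eq_iff)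
  have "(A - outer w) ** dagger T = A - outer w"
  proof -
    have "((A - outer w) ** dagger T) $ k $ l = (A - outer w) $ k $ l" for k l
    proof -
      have z: "A $ k $ i = outer w $ k $ i" using dpos by (simp add: w d)
      have "((A - outer w) ** dagger T) $ k $ l =
        (\<Sum>j\<in>UNIV. (if l = j then (A - outer w) $ k $ l else 0)
          - (if j = i then (A - outer w) $ k $ i * cnj (A $ l $ i / d) else 0))"
        unfolding matrix_matrix_mult_def dagger_def T_def vec_lambda_beta
        by (rule sum.cong) (auto simp: algebra_simps)
      also have "\<dots> = (A - outer w) $ k $ l"
        by (simp add: sum_subtractf z)
      finally show ?thesis .
    qed
    then show ?thesis by (simp add: vec_eq_iff)
  qed
  then have "A - outer w = T ** A ** dagger T" using AT by simp
  then show "psd (A - outer w)" using psd_congruence[OF assms(1)] by metis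
qed

text \<open>\<open>I\<close> holds the rows that may still be nonzero. Each induction step clears
  one of them by a rank-one term; a zero pivot means that the row vanishes already, and the term is
  \<open>outer 0\<close>.\<close>

lemma psd_sum_outer_on:
  assumes "finite I" "psd A" "\<And>i k. i \<notin> I \<Longrightarrow> A $ i $ k = 0"
  shows "\<exists>w. A = (\<Sum>i\<in>I. outer (w i))"
  using assms
proof (induction I arbitrary: A rule: finite_induct)
  case empty
  then show ?case by (simp add: vec_eq_iff)
next
  case (insert i I)
  have "\<exists>u. psd (A - outer u) \<and> (\<forall>j k. j \<notin> I \<longrightarrow> (A - outer u) $ j $ k = 0)"
  proof (cases "A $ i $ i = 0")
    case True
    have "outer (0 :: complex^'a) = 0" by (simp add: outer_def vec_eq_iff)
    then show ?thesis
      using insert.prems psd_zero_diag[OF insert.prems(1) True]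
      by (intro exI[of _ 0]) (metis diff_zero insert_iff)
  next
    case False
    then show ?thesis
      using psd_schur_complement[OF insert.prems(1) False] insert.prems(2)
      by (metis insert_iff)
  qed
  then obtain u where u: "psd (A - outer u)" "\<And>j k. j \<notin> I \<Longrightarrow> (A - outer u) $ j $ k = 0"
    by blast
  from insert.IH[OF this] obtain w where w: "A - outer u = (\<Sum>j\<in>I. outer (w j))" by blast
  have "(\<Sum>j\<in>insert i I. outer ((w(i := u)) j)) = outer u + (\<Sum>j\<in>I. outer ((w(i := u)) j))"
    using insert.hyps by simp
  also have "(\<Sum>j\<in>I. outer ((w(i := u)) j)) = (\<Sum>j\<in>I. outer (w j))"
    by (rule sum.cong) (use insert.hyps in auto)
  finally have "A = (\<Sum>j\<in>insert i I. outer ((w(i := u)) j))"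
    by (simp flip: w)
  then show ?case by blast
qed

lemma psd_sum_outer:
  fixes A :: "complex^'n^'n"
  assumes "psd A"
  obtains w :: "'n \<Rightarrow> complex^'n" where "A = (\<Sum>i\<in>UNIV. outer (w i))"
  using psd_sum_outer_on[OF finite_class.finite_UNIV assms] by auto

section \<open>Conditional states\<close>

lemma ptrace_on_first_two_entry:
  "ptrace_first_two (on_first_two E ** (A \<otimes>\<^sub>o \<rho>)) $ k $ l =
     (\<Sum>i\<in>UNIV. \<Sum>j\<in>UNIV. \<Sum>i'\<in>UNIV. \<Sum>j'\<in>UNIV.
        E $ (i,j) $ (i',j') * (A $ i' $ i * \<rho> $ (j',k) $ (j,l)))"
proof -
  have *: "(\<Sum>k'\<in>UNIV. e * (mat 1 :: qubit_op) $ k $ k' * f k') = e * f k" for e :: complex and f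
    using exhaust_2[of k] by (auto simp: sum_2 mat1_entries)
  show ?thesis
    by (simp add: ptrace_first_two_def on_first_two_def matrix_matrix_mult_def tensor_def
        sum_prod_UNIV *)
qed

text \<open>For a rank-one effect and a rank-one input, the map from the resource to the conditional
  operator has a single Kraus operator.\<close>

lemma psd_conditional_outer:
  fixes e :: "complex^(2 \<times> 2)" and \<psi> :: "complex^2"
  assumes "psd \<rho>"
  shows "psd (ptrace_first_two (on_first_two (outer e) ** (outer \<psi> \<otimes>\<^sub>o \<rho>)))"
proof -
  \<comment> \<open>\<open>N\<close> contracts the bra of \<open>e\<close> with
    \<open>\<psi>\<close> on the input qubit. What remains is a bra on the first resource qubit,
    tensored with the identity on the second.\<close>
  define N :: "complex^(2 \<times> 2)^2" where
    "N = (\<chi> k q. if snd q = k then \<Sum>i\<in>UNIV. cnj (e $ (i, fst q)) * \<psi> $ i else 0)"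
  have "ptrace_first_two (on_first_two (outer e) ** (outer \<psi> \<otimes>\<^sub>o \<rho>)) = N ** \<rho> ** dagger N"
    unfolding vec_eq_iff forall_2 ptrace_on_first_two_entry
    by (simp add: matrix_matrix_mult_def dagger_def N_def outer_def sum_prod_UNIV sum_2 algebra_simps)
  then show ?thesis using psd_congruence[OF assms] by metis
qed

text \<open>The conditional operator is additive in the effect and in the input separately, so
  rank-one decompositions of both reduce the claim to a sum of Kraus terms.\<close>

lemma psd_conditional:
  assumes "psd E" "psd A" "psd \<rho>"
  shows "psd (ptrace_first_two (on_first_two E ** (A \<otimes>\<^sub>o \<rho>)))"
proof -
  obtain e :: "2 \<times> 2 \<Rightarrow> complex^(2 \<times> 2)" where e: "E = (\<Sum>a\<in>UNIV. outer (e a))"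
    by (rule psd_sum_outer[OF assms(1)])
  obtain \<psi> :: "2 \<Rightarrow> complex^2" where \<psi>: "A = (\<Sum>b\<in>UNIV. outer (\<psi> b))"
    by (rule psd_sum_outer[OF assms(2)])
  have E: "on_first_two E = (\<Sum>a\<in>UNIV. on_first_two (outer (e a)))"
    by (simp add: e on_first_two_def vec_eq_iff sum_distrib_right)
  have A: "A \<otimes>\<^sub>o \<rho> = (\<Sum>b\<in>UNIV. outer (\<psi> b) \<otimes>\<^sub>o \<rho>)"
    by (simp add: \<psi> tensor_def vec_eq_iff sum_distrib_right)
  have l: "sum f S ** M = (\<Sum>x\<in>S. f x ** M)" for f :: "'z \<Rightarrow> qubit3_op" and S M
    by (induction S rule: infinite_finite_induct) (simp_all add: mat_mult_add_left)
  have r: "M ** sum f S = (\<Sum>x\<in>S. M ** f x)" for f :: "'z \<Rightarrow> qubit3_op" and S M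
    by (induction S rule: infinite_finite_induct) (simp_all add: matrix_add_ldistrib)
  have pt: "ptrace_first_two (sum f S) = (\<Sum>x\<in>S. ptrace_first_two (f x))" for f :: "'z \<Rightarrow> qubit3_op" and S
  proof -
    have "ptrace_first_two (A + B) = ptrace_first_two A + ptrace_first_two B" for A B
      by (simp add: ptrace_first_two_def vec_eq_iff sum.distrib)
    moreover have "ptrace_first_two 0 = 0"
      by (simp add: ptrace_first_two_def vec_eq_iff)
    ultimately show ?thesis
      by (induction S rule: infinite_finite_induct) simp_all
  qed
  show ?thesis
    unfolding E A l r pt by (intro psd_sum psd_conditional_outer assms(3))
qed

section \<open>Trace distance and fidelity in terms of Bloch vectors\<close>

lemma sigma_dot_linear:
  "sigma_dot (a + b) = sigma_dot a + sigma_dot b" "sigma_dot (a - b) = sigma_dot a - sigma_dot b"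
  "sigma_dot (r *\<^sub>R a) = r *\<^sub>R sigma_dot a"
  by (simp_all add: sigma_dot_def algebra_simps sum.distrib sum_subtractf scaleR_sum_right)

lemma dagger_sigma_dot: "dagger (sigma_dot a) = sigma_dot a"
  by (simp add: vec_eq_iff forall_2 dagger_def sigma_dot_entries complex_eq_iff)

text \<open>The Clifford relation of the Pauli operators; the products of Bloch states below are
  computed from it without returning to matrix entries.\<close>

lemma sigma_dot_anticommutator:
  "sigma_dot a ** sigma_dot b + sigma_dot b ** sigma_dot a = (2 * (a \<bullet> b)) *\<^sub>R mat 1"
  by (simp add: vec_eq_iff forall_2 matrix_matrix_mult_def sum_2 sigma_dot_entries mat1_entries
      complex_eq_iff inner_vec_def sum_3 algebra_simps)

lemma sigma_dot_square: "sigma_dot a ** sigma_dot a = (norm a)\<^sup>2 *\<^sub>R mat 1"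
proof -
  have "2 *\<^sub>R (sigma_dot a ** sigma_dot a) = 2 *\<^sub>R ((norm a)\<^sup>2 *\<^sub>R mat 1)"
    using sigma_dot_anticommutator[of a a] by (simp add: power2_norm_eq_inner scaleR_2)
  then show ?thesis by (simp only: scaleR_cancel_left) simp
qed

lemma dagger_bloch_state: "dagger (bloch_state a) = bloch_state a"
  by (simp add: bloch_state_def dagger_scaleR dagger_add dagger_mat_1 dagger_sigma_dot)

lemma trace_qubit_1: "trace (mat 1 :: qubit_op) = 2"
  by (simp add: trace_def sum_2 mat1_entries)

lemma trace_bloch_state: "trace (bloch_state a) = 1"
  by (simp add: bloch_state_def trace_scaleR trace_add trace_sigma_dot trace_qubit_1
      complex_eq_iff)

lemma pure_bloch_state_idem:
  assumes "norm a = 1"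
  shows "bloch_state a ** bloch_state a = bloch_state a"
proof -
  have "(mat 1 + sigma_dot a) ** (mat 1 + sigma_dot a) = 2 *\<^sub>R (mat 1 + sigma_dot a)"
    using sigma_dot_square[of a] assms
    by (simp add: mat_mult_add_left matrix_add_ldistrib scaleR_2 add_ac)
  then show ?thesis by (simp add: bloch_state_def scaleR_mat_mult)
qed

lemma psd_pure_bloch_state: "norm a = 1 \<Longrightarrow> psd (bloch_state a)"
  using psd_mult_dagger[of "bloch_state a"] by (simp add: dagger_bloch_state pure_bloch_state_idem)

text \<open>A pure Bloch state is a rank-one projection, so the sandwich is a multiple of it; the
  factor is the transition probability.\<close>

lemma pure_bloch_state_sandwich:
  assumes "norm a = 1"
  shows "bloch_state a ** bloch_state b ** bloch_state a = ((1 + a \<bullet> b) / 2) *\<^sub>R bloch_state a"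
proof -
  define S T where "S = sigma_dot b" and "T = sigma_dot a"
  define c where "c = 2 * (a \<bullet> b)"
  have TT: "T ** T = mat 1" using sigma_dot_square[of a] assms by (simp add: T_def)
  have TS: "T ** S = c *\<^sub>R mat 1 - S ** T"
    using sigma_dot_anticommutator[of a b] by (simp add: S_def T_def c_def algebra_simps)
  have TST: "T ** S ** T = c *\<^sub>R T - S"
    by (simp add: TS mat_mult_diff scaleR_mat_mult TT flip: matrix_mul_assoc)
  have "(mat 1 + T) ** (mat 1 + S) ** (mat 1 + T) = (2 + c) *\<^sub>R (mat 1 + T)"
    by (simp add: mat_mult_add_left matrix_add_ldistrib TST TT)
      (simp add: TS algebra_simps scaleR_2)
  then show ?thesis
    by (simp add: bloch_state_def scaleR_mat_mult S_def T_def c_def)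
qed

text \<open>The difference of the states is Hermitian with square a multiple of the identity, so its
  modulus is the multiple \<open>norm (a - b) / 2\<close> of the identity.\<close>

lemma trace_distance_bloch_state:
  "trace_distance (bloch_state a) (bloch_state b) = norm (a - b) / 2"
proof -
  have "bloch_state a - bloch_state b = (1/2) *\<^sub>R sigma_dot (a - b)"
    by (simp add: bloch_state_def sigma_dot_linear algebra_simps)
  moreover have "op_abs ((1/2) *\<^sub>R sigma_dot (a - b)) = (norm (a - b) / 2) *\<^sub>R mat 1"
    unfolding op_abs_def
    by (rule op_sqrt_eq)
      (simp_all add: psd_scaleR psd_mat_1 dagger_scaleR dagger_sigma_dot scaleR_mat_mult
        sigma_dot_square power2_eq_square)
  ultimately show ?thesis
    by (simp add: trace_distance_def trace_scaleR trace_qubit_1)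
qed

text \<open>The pure state is its own square root, so the operator under the outer root is
  \<open>c\<close> times a projection, with root \<open>sqrt c\<close> times that projection.
  Positivity of the second state gives \<open>c \<ge> 0\<close>.\<close>

lemma fidelity_bloch_state:
  assumes "norm a = 1" "psd (bloch_state b)"
  shows "fidelity (bloch_state a) (bloch_state b) = (1 + a \<bullet> b) / 2"
proof -
  define c where "c = (1 + a \<bullet> b) / 2"
  note pa = psd_pure_bloch_state[OF assms(1)] and idem = pure_bloch_state_idem[OF assms(1)]
  have sq: "op_sqrt (bloch_state a) = bloch_state a"
    using pa idem by (rule op_sqrt_eq)
  have sand: "bloch_state a ** bloch_state b ** bloch_state a = c *\<^sub>R bloch_state a"
    unfolding c_def by (rule pure_bloch_state_sandwich[OF assms(1)])
  have "psd (c *\<^sub>R bloch_state a)"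
    using psd_congruence[OF assms(2), of "bloch_state a"] sand by (simp add: dagger_bloch_state)
  then have c: "c \<ge> 0"
    using psd_trace_nonneg by (fastforce simp: trace_scaleR trace_bloch_state)
  have "op_sqrt (c *\<^sub>R bloch_state a) = sqrt c *\<^sub>R bloch_state a"
    using c pa by (intro op_sqrt_eq) (simp_all add: psd_scaleR scaleR_mat_mult idem)
  then have "fidelity (bloch_state a) (bloch_state b) = (sqrt c)\<^sup>2"
    by (simp add: fidelity_def sq sand trace_scaleR trace_bloch_state)
  then show ?thesis using c by (simp add: c_def)
qed

text \<open>A Hermitian qubit operator of trace one is determined by its Pauli coefficients. This
  carries the Bloch vector formulas over to output states.\<close>

lemma bloch_state_bloch_vector:
  assumes "density_op \<rho>"
  shows "bloch_state (bloch_vector \<rho>) = \<rho>"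
proof -
  have h: "dagger \<rho> = \<rho>" and tr: "\<rho> $ 1 $ 1 + \<rho> $ 2 $ 2 = 1"
    using assms by (auto simp: density_op_def psd_def trace_def sum_2)
  have tr': "Re (\<rho> $ 1 $ 1) + Re (\<rho> $ 2 $ 2) = 1"
    using arg_cong[OF tr, of Re] by simp
  show ?thesis
    using tr' herm_diag[OF h, of 1] herm_diag[OF h, of 2] herm_entry[OF h, of 2 1]
    by (simp add: vec_eq_iff forall_2 bloch_state_def bloch_vector_def sigma_dot_entries mat1_entries
        complex_eq_iff trace_def matrix_matrix_mult_def sum_2 pauli_entries)
qed

section \<open>Outcomes of a protocol\<close>

definition unnormalised_output :: "'m qtp \<Rightarrow> 'm \<Rightarrow> real^3 \<Rightarrow> qubit_op" where
  "unnormalised_output Q m t =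
     correction Q m ** ptrace_first_two (measured Q m t) ** dagger (correction Q m)"

lemma
  assumes "is_qtp Q" "m \<in> outcomes Q" "norm t = 1"
  shows psd_unnormalised_output: "psd (unnormalised_output Q m t)"
    and trace_unnormalised_output: "trace (unnormalised_output Q m t) = outcome_prob Q m t"
proof -
  let ?K = "ptrace_first_two (measured Q m t)"
  have K: "psd ?K"
    unfolding measured_def using assms
    by (intro psd_conditional psd_pure_bloch_state) (auto simp: is_qtp_def density_op_def)
  then show "psd (unnormalised_output Q m t)"
    unfolding unnormalised_output_def by (rule psd_congruence)
  have "dagger (correction Q m) ** correction Q m = mat 1"
    using assms by (auto simp: is_qtp_def unitary_def)
  then have "trace (unnormalised_output Q m t) = trace ?K"
    unfolding unnormalised_output_def
    by (subst trace_mat_mult_commute) (simp add: matrix_mul_assoc)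
  \<comment> \<open>\<open>outcome_prob\<close> is only the real part of the trace, but a Hermitian
    operator has a real diagonal.\<close>
  also have "\<dots> = outcome_prob Q m t"
    using K by (simp add: outcome_prob_def trace_measured complex_eq_iff psd_def)
      (simp add: trace_def herm_diag)
  finally show "trace (unnormalised_output Q m t) = outcome_prob Q m t" .
qed

lemma outcome_prob_nonneg:
  assumes "is_qtp Q" "m \<in> outcomes Q" "norm t = 1"
  shows "0 \<le> outcome_prob Q m t"
  using psd_trace_nonneg[OF psd_unnormalised_output[OF assms]] trace_unnormalised_output[OF assms]
  by simp

text \<open>Completeness of the POVM turns the sum into the trace of the joint state, which factors
  into two traces equal to one.\<close>

lemma sum_outcome_prob:
  assumes "is_qtp Q"
  shows "(\<Sum>m\<in>outcomes Q. outcome_prob Q m t) = 1"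
proof -
  let ?M = "bloch_state t \<otimes>\<^sub>o resource Q"
  have E: "(\<Sum>m\<in>outcomes Q. effect Q m) = mat 1" and tr: "trace (resource Q) = 1"
    using assms by (auto simp: is_qtp_def density_op_def)
  have 1: "(\<Sum>m\<in>outcomes Q. on_first_two (effect Q m)) = mat 1"
  proof -
    have "(\<Sum>m\<in>outcomes Q. on_first_two (effect Q m)) = on_first_two (\<Sum>m\<in>outcomes Q. effect Q m)"
      by (simp add: on_first_two_def vec_eq_iff sum_distrib_right)
    then show ?thesis
      by (simp add: E on_first_two_def mat_def vec_eq_iff prod_eq_iff)
  qed
  have trace0: "trace (0 :: qubit3_op) = 0" by (simp add: trace_def)
  have "(\<Sum>m\<in>S. trace (f m ** ?M)) = trace ((\<Sum>m\<in>S. f m) ** ?M)" for f :: "'a \<Rightarrow> qubit3_op" and S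
    by (induction S rule: infinite_finite_induct) (simp_all add: mat_mult_add_left trace_add trace0)
  then have "(\<Sum>m\<in>outcomes Q. trace (measured Q m t)) = trace ?M"
    by (simp add: measured_def 1)
  also have "\<dots> = trace (bloch_state t) * trace (resource Q)"
    by (simp add: trace_def tensor_def sum_prod_UNIV sum_2 algebra_simps)
  finally show ?thesis
    by (simp add: outcome_prob_def tr trace_bloch_state flip: Re_sum)
qed

lemma output_state_conv:
  "output_state Q m t = (1 / outcome_prob Q m t) *\<^sub>R unnormalised_output Q m t"
  by (simp add: output_state_def unnormalised_output_def)

lemma density_op_output_state:
  assumes "is_qtp Q" "m \<in> outcomes Q" "norm t = 1" "outcome_prob Q m t > 0"
  shows "density_op (output_state Q m t)"
  using assms psd_unnormalised_output[OF assms(1-3)]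
  by (simp add: density_op_def output_state_conv psd_scaleR trace_scaleR
      trace_unnormalised_output complex_eq_iff)

lemma bloch_vector_scaleR: "bloch_vector (r *\<^sub>R A) = r *\<^sub>R bloch_vector A"
  by (simp add: bloch_vector_def vec_eq_iff scaleR_mat_mult trace_scaleR)

text \<open>If the probability vanishes, the unnormalised output is positive semidefinite with trace
  zero, hence zero, and both sides are zero.\<close>

lemma bloch_vector_unnormalised_output:
  assumes "is_qtp Q" "m \<in> outcomes Q" "norm t = 1"
  shows "bloch_vector (unnormalised_output Q m t) =
    outcome_prob Q m t *\<^sub>R bloch_vector (output_state Q m t)"
proof (cases "outcome_prob Q m t = 0")
  case True
  then have "unnormalised_output Q m t = 0"
    using psd_trace_eq_0[OF psd_unnormalised_output[OF assms]] trace_unnormalised_output[OF assms]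
    by simp
  then show ?thesis using True bloch_vector_scaleR[of 0 0] by simp
qed (simp add: output_state_conv bloch_vector_scaleR)

lemma outcome_trace_distance:
  assumes "is_qtp Q" "m \<in> outcomes Q" "norm t = 1"
  shows "outcome_prob Q m t * trace_distance (bloch_state t) (output_state Q m t) =
    outcome_prob Q m t * (norm (t - bloch_vector (output_state Q m t)) / 2)"
  using outcome_prob_nonneg[OF assms] density_op_output_state[OF assms]
  by (cases "outcome_prob Q m t = 0")
    (auto simp flip: trace_distance_bloch_state simp: bloch_state_bloch_vector)

lemma outcome_fidelity:
  assumes "is_qtp Q" "m \<in> outcomes Q" "norm t = 1"
  shows "outcome_prob Q m t * fidelity (bloch_state t) (output_state Q m t) =
    outcome_prob Q m t * ((1 + t \<bullet> bloch_vector (output_state Q m t)) / 2)"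
proof (cases "outcome_prob Q m t = 0")
  case False
  then have d: "density_op (output_state Q m t)"
    using outcome_prob_nonneg[OF assms] density_op_output_state[OF assms] by simp
  then show ?thesis
    using fidelity_bloch_state[OF assms(3), of "bloch_vector (output_state Q m t)"]
    by (simp add: bloch_state_bloch_vector density_op_def)
qed simp

lemma one_le_trace_distance_plus_fidelity:
  assumes "is_qtp Q" "norm t = 1"
  shows "1 \<le> mean_over_outcomes trace_distance Q t + mean_over_outcomes fidelity Q t"
proof -
  have "1 = (\<Sum>m\<in>outcomes Q. outcome_prob Q m t)"
    using sum_outcome_prob[OF assms(1)] by simp
  also have "\<dots> \<le> (\<Sum>m\<in>outcomes Q. outcome_prob Q m t * trace_distance (bloch_state t) (output_state Q m t)
      + outcome_prob Q m t * fidelity (bloch_state t) (output_state Q m t))"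
  proof (rule sum_mono)
    fix m assume m: "m \<in> outcomes Q"
    define u where "u = bloch_vector (output_state Q m t)"
    have "1 - t \<bullet> u \<le> norm (t - u)"
      using norm_cauchy_schwarz[of t "t - u"] assms(2) by (simp add: inner_diff_right dot_square_norm)
    then have "1 \<le> norm (t - u) / 2 + (1 + t \<bullet> u) / 2"
      by (simp add: field_simps)
    then have "outcome_prob Q m t * 1 \<le> outcome_prob Q m t * (norm (t - u) / 2 + (1 + t \<bullet> u) / 2)"
      by (intro mult_left_mono outcome_prob_nonneg assms m)
    then show "outcome_prob Q m t \<le> outcome_prob Q m t * trace_distance (bloch_state t) (output_state Q m t)
      + outcome_prob Q m t * fidelity (bloch_state t) (output_state Q m t)"
      unfolding outcome_trace_distance[OF assms(1) m assms(2)] outcome_fidelity[OF assms(1) m assms(2)]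
      by (simp add: u_def distrib_left)
  qed
  finally show ?thesis
    by (simp add: mean_over_outcomes_def sum.distrib)
qed

lemma aligned_trace_distance_plus_fidelity:
  assumes "is_qtp Q" "norm t = 1" "aligned_with Q s"
  shows "mean_over_outcomes trace_distance Q t + mean_over_outcomes fidelity Q t = 1"
proof -
  have "outcome_prob Q m t * trace_distance (bloch_state t) (output_state Q m t)
      + outcome_prob Q m t * fidelity (bloch_state t) (output_state Q m t) = outcome_prob Q m t"
    if m: "m \<in> outcomes Q" for m
  proof (cases "outcome_prob Q m t = 0")
    case False
    then have "bloch_vector (output_state Q m t) = s m *\<^sub>R t" and s: "s m \<le> 1"
      using assms m outcome_prob_nonneg[OF assms(1) m assms(2)] by (auto simp: aligned_with_def)
    \<comment> \<open>The difference is \<open>(1 - s m) *\<^sub>R t\<close>; the bound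
      \<open>s m \<le> 1\<close> removes the absolute value, giving equality in
      Cauchy--Schwarz.\<close>
    moreover have "norm (t - s m *\<^sub>R t) = 1 - s m"
      using norm_scaleR[of "1 - s m" t] assms(2) s by (simp add: algebra_simps)
    ultimately show ?thesis
      unfolding outcome_trace_distance[OF assms(1) m assms(2)] outcome_fidelity[OF assms(1) m assms(2)]
      using assms(2) by (simp add: dot_square_norm flip: distrib_left) (simp add: field_simps)
  qed simp
  then show ?thesis
    using sum_outcome_prob[OF assms(1)]
    by (simp add: mean_over_outcomes_def flip: sum.distrib)
qed

section \<open>Averages over the sphere\<close>

lemma norm_sphere_point: "norm (sphere_point \<theta> \<phi>) = 1"
proof -
  have "sphere_point \<theta> \<phi> \<bullet> sphere_point \<theta> \<phi> =
      sin \<theta> * cos \<phi> * (sin \<theta> * cos \<phi>) + sin \<theta> * sin \<phi> * (sin \<theta> * sin \<phi>) + cos \<theta> * cos \<theta>"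
    by (simp add: sphere_point_def inner_vec_def sum_3)
  also have "\<dots> = 1"
    using sin_cos_squared_add3[of \<theta>] sin_cos_squared_add3[of \<phi>] by algebra
  finally show ?thesis by (simp add: norm_eq_1)
qed

text \<open>The integrand is continuous on a compact rectangle. Continuity of \<open>f\<close> on
  the sphere is enough, as \<open>sphere_point\<close> takes its values there.\<close>

lemma set_integrable_sphere_point:
  assumes "continuous_on (sphere 0 1) f"
  shows "set_integrable lborel ({0..pi} \<times> {0..2 * pi})
    (\<lambda>x. f (sphere_point (fst x) (snd x)) * sin (fst x))"
proof -
  have "continuous_on A (\<lambda>x. sphere_point (fst x) (snd x) $ i)" for A i
    using exhaust_3[of i]
    by (elim disjE) (simp_all add: sphere_point_def, (intro continuous_intros)+)
  then have "continuous_on A (\<lambda>x. sphere_point (fst x) (snd x))" for A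
    using continuous_on_vec_lambda[of A "\<lambda>i x. sphere_point (fst x) (snd x) $ i"] by simp
  then have "continuous_on ({0..pi} \<times> {0..2 * pi})
      (\<lambda>x. f (sphere_point (fst x) (snd x)) * sin (fst x))"
    by (intro continuous_intros continuous_on_compose2[OF assms]) (auto simp: norm_sphere_point)
  then show ?thesis
    unfolding set_integrable_def
    by (intro borel_integrable_compact compact_Times) auto
qed

lemma sphere_average_add:
  assumes "continuous_on (sphere 0 1) f" "continuous_on (sphere 0 1) g"
  shows "sphere_average (\<lambda>t. f t + g t) = sphere_average f + sphere_average g"
  using set_integrable_sphere_point[OF assms(1)] set_integrable_sphere_point[OF assms(2)]
  by (simp add: sphere_average_def distrib_left distrib_right set_integral_add)

lemma sphere_average_mono:
  assumes "continuous_on (sphere 0 1) f" "continuous_on (sphere 0 1) g"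
    and "\<And>t. norm t = 1 \<Longrightarrow> f t \<le> g t"
  shows "sphere_average f \<le> sphere_average g"
  unfolding sphere_average_def
  by (intro mult_left_mono set_integral_mono set_integrable_sphere_point assms)
    (auto intro!: mult_right_mono assms sin_ge_zero simp: norm_sphere_point)

section \<open>Continuity of the mean trace distance and the mean fidelity on pure inputs\<close>

lemma continuous_on_matrix_mult:
  fixes f :: "'a::topological_space \<Rightarrow> complex^'n^'m" and g :: "'a \<Rightarrow> complex^'k^'n"
  assumes "continuous_on S f" "continuous_on S g"
  shows "continuous_on S (\<lambda>x. f x ** g x)"
  unfolding matrix_matrix_mult_def by (intro continuous_intros assms)

lemma continuous_on_bloch_state: "continuous_on S bloch_state"
  unfolding bloch_state_def sigma_dot_def by (intro continuous_intros)

lemma continuous_on_unnormalised_output: "continuous_on S (unnormalised_output Q m)"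
proof -
  have tensor: "continuous_on S (\<lambda>t. bloch_state t \<otimes>\<^sub>o resource Q)"
    unfolding tensor_def by (intro continuous_intros continuous_on_bloch_state)
  have ptrace: "continuous_on S (\<lambda>t. ptrace_first_two (f t))" if "continuous_on S f"
    for f :: "real^3 \<Rightarrow> qubit3_op"
    unfolding ptrace_first_two_def by (intro continuous_intros that)
  show ?thesis
    unfolding unnormalised_output_def measured_def
    by (intro continuous_on_matrix_mult ptrace tensor continuous_on_const)
qed

lemma continuous_on_outcome_prob: "continuous_on S (outcome_prob Q m)"
  unfolding outcome_prob_def measured_def trace_def tensor_def matrix_matrix_mult_def
  by (intro continuous_intros continuous_on_bloch_state)

lemma continuous_on_bloch_vector_output:
  "continuous_on S (\<lambda>t. bloch_vector (unnormalised_output Q m t))"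
  unfolding bloch_vector_def trace_def
  by (intro continuous_intros continuous_on_matrix_mult continuous_on_unnormalised_output)

lemma continuous_on_mean_trace_distance:
  assumes "is_qtp Q"
  shows "continuous_on (sphere 0 1) (mean_over_outcomes trace_distance Q)"
proof -
  \<comment> \<open>The nonnegative probability is moved inside the norm, where it cancels the
    normalisation of the output; every summand is then visibly continuous.\<close>
  have eq: "mean_over_outcomes trace_distance Q t = (\<Sum>m\<in>outcomes Q.
      norm (outcome_prob Q m t *\<^sub>R t - bloch_vector (unnormalised_output Q m t)) / 2)"
    if "t \<in> sphere 0 1" for t
    unfolding mean_over_outcomes_def
  proof (rule sum.cong[OF refl])
    fix m assume m: "m \<in> outcomes Q"
    have t: "norm t = 1" using that by simp
    show "outcome_prob Q m t * trace_distance (bloch_state t) (output_state Q m t) =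
        norm (outcome_prob Q m t *\<^sub>R t - bloch_vector (unnormalised_output Q m t)) / 2"
      unfolding outcome_trace_distance[OF assms m t] bloch_vector_unnormalised_output[OF assms m t]
      using outcome_prob_nonneg[OF assms m t] by (simp flip: scaleR_diff_right)
  qed
  have "continuous_on (sphere 0 1) (\<lambda>t. \<Sum>m\<in>outcomes Q.
      norm (outcome_prob Q m t *\<^sub>R t - bloch_vector (unnormalised_output Q m t)) / 2)"
    by (intro continuous_intros continuous_on_outcome_prob continuous_on_bloch_vector_output) simp_all
  then show ?thesis by (rule continuous_on_eq) (rule eq[symmetric])
qed

lemma continuous_on_mean_fidelity:
  assumes "is_qtp Q"
  shows "continuous_on (sphere 0 1) (mean_over_outcomes fidelity Q)"
proof -
  have eq: "mean_over_outcomes fidelity Q t = (\<Sum>m\<in>outcomes Q.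
      (outcome_prob Q m t + t \<bullet> bloch_vector (unnormalised_output Q m t)) / 2)"
    if "t \<in> sphere 0 1" for t
    unfolding mean_over_outcomes_def
  proof (rule sum.cong[OF refl])
    fix m assume m: "m \<in> outcomes Q"
    have t: "norm t = 1" using that by simp
    show "outcome_prob Q m t * fidelity (bloch_state t) (output_state Q m t) =
        (outcome_prob Q m t + t \<bullet> bloch_vector (unnormalised_output Q m t)) / 2"
      unfolding outcome_fidelity[OF assms m t] bloch_vector_unnormalised_output[OF assms m t]
      by (simp add: distrib_left)
  qed
  have "continuous_on (sphere 0 1) (\<lambda>t. \<Sum>m\<in>outcomes Q.
      (outcome_prob Q m t + t \<bullet> bloch_vector (unnormalised_output Q m t)) / 2)"
    by (intro continuous_intros continuous_on_outcome_prob continuous_on_bloch_vector_output) simp_all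
  then show ?thesis by (rule continuous_on_eq) (rule eq[symmetric])
qed

theorem theorem1:
  fixes \<alpha> :: real and Q :: "'m qtp" and Q' :: "'n qtp"
  assumes "0 < \<alpha>" and "\<alpha> \<le> 1"
    and "is_qtp Q"
    and "average_over_inputs fidelity Q = \<alpha>"
    and "\<exists>s. aligned_with Q s \<and>
           (\<forall>t. norm t \<le> 1 \<longrightarrow> (\<Sum>m\<in>outcomes Q. outcome_prob Q m t * s m) = 2 * \<alpha> - 1)"
    and "is_qtp Q'"
    and "average_over_inputs fidelity Q' = \<alpha>"
  shows "average_over_inputs trace_distance Q \<le> average_over_inputs trace_distance Q'"
proof -
  note cont = continuous_on_mean_trace_distance continuous_on_mean_fidelity
  have split: "average_over_inputs trace_distance R + average_over_inputs fidelity R =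
      sphere_average (\<lambda>t. mean_over_outcomes trace_distance R t + mean_over_outcomes fidelity R t)"
    if "is_qtp R" for R :: "'r qtp"
    using sphere_average_add[OF cont[OF that]] by (simp add: average_over_inputs_def)
  obtain s where s: "aligned_with Q s" using assms(5) by blast
  \<comment> \<open>Adding the common fidelity \<open>\<alpha>\<close> to both sides makes the claim
    a comparison of averages whose integrands are pointwise equal to 1 for \<open>Q\<close> and at
    least 1 for \<open>Q'\<close>.\<close>
  have "average_over_inputs trace_distance Q + \<alpha> =
      sphere_average (\<lambda>t. mean_over_outcomes trace_distance Q t + mean_over_outcomes fidelity Q t)"
    using split[OF assms(3)] assms(4) by simp
  also have "\<dots> \<le> sphere_average (\<lambda>t. mean_over_outcomes trace_distance Q' t + mean_over_outcomes fidelity Q' t)"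
    using aligned_trace_distance_plus_fidelity[OF assms(3) _ s]
      one_le_trace_distance_plus_fidelity[OF assms(6)]
    by (intro sphere_average_mono continuous_on_add cont assms) simp
  also have "\<dots> = average_over_inputs trace_distance Q' + \<alpha>"
    using split[OF assms(6)] assms(7) by simp
  finally show ?thesis by simp
qed

end
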